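(* Let $1<p<2$ and $2<q<\infty$ satisfy $\frac1p+\frac1q=1$. Let $F=(F_n)_{n\in\mathbb{Z}}$ be a sequence of complex numbers with $|F_n|<1$ for every $n$ and with only finitely many $F_n$ nonzero. Let $A_n=(1-|F_n|^2)^{-1/2}$, and let $a\colon\mathbb{T}\to\mathbb{C}$ be the upper-left entry of the $\mathrm{SU}(1,1)$-valued trigonometric product with coefficients $F$. If $\|F\|_{\ell^1(\mathbb{Z})}\leq \frac12$, then \[ \big\|(\log|a(t)|^2)^{1/2}\big\|_{\mathrm{L}^q_t(\mathbb{T})} \leq \big(1+3\|F\|_{\ell^1(\mathbb{Z})}\big)\,\big\|(\log|A_n|^2)^{1/2}\big\|_{\ell^p_n(\mathbb{Z})}. \]
   Context: $\mathbb{T}=\mathbb{R}/\mathbb{Z}\equiv[0,1)$ carries Lebesgue measure of total mass $1$. For a sequence $F=(F_n)_{n\in\mathbb{Z}}$ of complex numbers in the open unit disk with only finitely many nonzero terms, set \[ A_n := \frac{1}{(1-|F_n|^2)^{1/2}},\qquad B_n := \frac{F_n}{(1-|F_n|^2)^{1/2}}, \] so that $A_n>0$ and $A_n^2-|B_n|^2=1$. The $\mathrm{SU}(1,1)$-valued trigonometric (Fourier) product with coefficients $F$ is defined for $t\in\mathbb{T}$ by \[ \begin{bmatrix} a(t) & b(t) \\ \overline{b(t)} & \overline{a(t)} \end{bmatrix} := \prod_{n=-\infty}^{\infty} \begin{bmatrix} A_n & B_n e^{2\pi i n t} \\ \overline{B_n} e^{-2\pi i n t} & A_n \end{bmatrix},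 \] where the matrices are multiplied from left to right as $n$ increases. Only finitely many factors differ from the identity matrix, so the product is effectively finite. For each $t$ the product lies in \[ \mathrm{SU}(1,1)=\Big\{\begin{bmatrix}\alpha&\beta\\ \overline\beta&\overline\alpha\end{bmatrix}:\alpha,\beta\in\mathbb{C},\ |\alpha|^2-|\beta|^2=1\Big\}, \] so $|a(t)|\ge1$ and $\log|a(t)|^2\geq 0$. The subscripts $t$ and $n$ in $\mathrm{L}^q_t(\mathbb{T})$ and $\ell^p_n(\mathbb{Z})$ indicate the variable in which the norm is taken. *)

theory Defs
  imports "HOL-Analysis.Analysis"
begin

definition coeff_A :: "(int \<Rightarrow> complex) \<Rightarrow> int \<Rightarrow> real" where
  "coeff_A F n = 1 / sqrt (1 - (cmod (F n))\<^sup>2)"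

definition coeff_B :: "(int \<Rightarrow> complex) \<Rightarrow> int \<Rightarrow> complex" where
  "coeff_B F n = F n / complex_of_real (sqrt (1 - (cmod (F n))\<^sup>2))"

definition su11_factor :: "(int \<Rightarrow> complex) \<Rightarrow> real \<Rightarrow> int \<Rightarrow> complex^2^2" where
  "su11_factor F t n = vector
     [vector [complex_of_real (coeff_A F n), coeff_B F n * cis (2 * pi * of_int n * t)],
      vector [cnj (coeff_B F n) * cis (- (2 * pi * of_int n * t)), complex_of_real (coeff_A F n)]]"

definition ordered_matrix_prod :: "(int \<Rightarrow> complex^2^2) \<Rightarrow> int list \<Rightarrow> complex^2^2" where
  "ordered_matrix_prod M ns = foldr (\<lambda>n P. M n ** P) ns (mat 1)"

text \<open>The product over all integers, taken from left to right as the index increases. Only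
  sequences with finite support are of interest (otherwise the product is the identity); the factors outside the support are identity
  matrices and are left out (see \<open>su11_product_eq_interval\<close> below).\<close>

definition su11_product :: "(int \<Rightarrow> complex) \<Rightarrow> real \<Rightarrow> complex^2^2" where
  "su11_product F t = ordered_matrix_prod (su11_factor F t) (sorted_list_of_set {n. F n \<noteq> 0})"

definition su11_a :: "(int \<Rightarrow> complex) \<Rightarrow> real \<Rightarrow> complex" where
  "su11_a F t = su11_product F t $ 1 $ 1"

definition su11_b :: "(int \<Rightarrow> complex) \<Rightarrow> real \<Rightarrow> complex" where
  "su11_b F t = su11_product F t $ 1 $ 2"

text \<open>Both norms are real-valued, so they carry their meaning only when the sum, respectively the
  integral, converges. Sequences of finite support are no problem for the first one; for the second
  one see \<open>integrable_su11_a\<close> below. The circle is represented by the interval \<open>[0, 1)\<close>.\<close>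

definition lp_norm :: "real \<Rightarrow> (int \<Rightarrow> 'a::real_normed_vector) \<Rightarrow> real" where
  "lp_norm p x = (\<Sum>\<^sub>\<infinity>n. norm (x n) powr p) powr (1 / p)"

definition Lq_norm :: "real \<Rightarrow> (real \<Rightarrow> 'a::real_normed_vector) \<Rightarrow> real" where
  "Lq_norm q f = (LINT t:{0..<1}|lborel. norm (f t) powr q) powr (1 / q)"

lemma su11_factor_eq_mat_1: "F n = 0 \<Longrightarrow> su11_factor F t n = mat 1"
  by (simp add: su11_factor_def coeff_A_def coeff_B_def vec_eq_iff forall_2 mat_def)

lemma ordered_matrix_prod_filter:
  assumes "\<And>n. n \<in> set ns \<Longrightarrow> \<not> P n \<Longrightarrow> M n = mat 1"
  shows "ordered_matrix_prod M (filter P ns) = ordered_matrix_prod M ns"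
  using assms by (induction ns) (auto simp: ordered_matrix_prod_def)

lemma su11_product_eq_interval:
  assumes "\<And>n. F n \<noteq> 0 \<Longrightarrow> n \<in> {i..j}"
  shows "su11_product F t = ordered_matrix_prod (su11_factor F t) [i..j]"
proof -
  have *: "{n. F n \<noteq> 0} = set (filter (\<lambda>n. F n \<noteq> 0) [i..j])"
    using assms by auto
  have "sorted_list_of_set {n. F n \<noteq> 0} = filter (\<lambda>n. F n \<noteq> 0) [i..j]"
    unfolding * by (rule sorted_list_of_set.idem_if_sorted_distinct) (auto simp: sorted_wrt_filter)
  then show ?thesis
    unfolding su11_product_def
    by (simp only:) (rule ordered_matrix_prod_filter, simp add: su11_factor_eq_mat_1)
qed

lemma ordered_matrix_prod_su11:
  assumes "\<And>n. cmod (F n) < 1"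
  defines "P \<equiv> \<lambda>t ns. ordered_matrix_prod (su11_factor F t) ns"
  shows "P t ns $ 2 $ 1 = cnj (P t ns $ 1 $ 2) \<and> P t ns $ 2 $ 2 = cnj (P t ns $ 1 $ 1) \<and>
         det (P t ns) = 1"
proof (induction ns)
  case Nil
  show ?case by (simp add: P_def ordered_matrix_prod_def mat_def det_2)
next
  case (Cons n ns)
  let ?F = "su11_factor F t n"
  have 1: "P t (n # ns) = ?F ** P t ns"
    by (simp add: P_def ordered_matrix_prod_def)
  have pos: "1 - (cmod (F n))\<^sup>2 > 0"
    using assms(1)[of n] by (simp add: power_less_one_iff abs_square_less_1)
  have "det ?F = of_real ((coeff_A F n)\<^sup>2) -
      (coeff_B F n * cnj (coeff_B F n)) * (cis (2 * pi * of_int n * t) * cis (- (2 * pi * of_int n * t)))"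
    by (simp add: det_2 su11_factor_def power2_eq_square del: cis_mult)
  also have "\<dots> = of_real ((coeff_A F n)\<^sup>2 - (cmod (coeff_B F n))\<^sup>2)"
    unfolding cis_mult by (simp flip: complex_norm_square)
  also have "(coeff_A F n)\<^sup>2 - (cmod (coeff_B F n))\<^sup>2 = 1"
    using pos by (simp add: coeff_A_def coeff_B_def norm_divide power_divide diff_divide_distrib [symmetric])
  finally have "det ?F = 1" by simp
  then have "det (?F ** P t ns) = 1"
    using Cons by (simp add: det_mul)
  then show ?case
    using Cons unfolding 1
    by (simp add: matrix_matrix_mult_def sum_2) (simp add: su11_factor_def cis_cnj)
qed

lemma continuous_on_ordered_matrix_prod:
  "continuous_on S (\<lambda>t. ordered_matrix_prod (su11_factor F t) ns $ i $ j)"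
proof (induction ns arbitrary: i j)
  case Nil
  show ?case by (simp add: ordered_matrix_prod_def)
next
  case (Cons n ns)
  have "continuous_on S (\<lambda>t. su11_factor F t n $ i $ k)" for k
    using exhaust_2[of i] exhaust_2[of k]
    by (elim disjE; simp add: su11_factor_def cis_conv_exp; intro continuous_intros)
  moreover have "ordered_matrix_prod (su11_factor F t) (n # ns) $ i $ j =
      (\<Sum>k\<in>UNIV. su11_factor F t n $ i $ k * ordered_matrix_prod (su11_factor F t) ns $ k $ j)" for t
    by (simp add: ordered_matrix_prod_def matrix_matrix_mult_def)
  ultimately show ?case
    using Cons by (simp only:) (intro continuous_on_sum continuous_on_mult)
qed

lemma su11_product_in_SU11:
  assumes "\<And>n. cmod (F n) < 1"
  shows "su11_product F t = vector [vector [su11_a F t, su11_b F t],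
           vector [cnj (su11_b F t), cnj (su11_a F t)]]"
    and "(cmod (su11_a F t))\<^sup>2 - (cmod (su11_b F t))\<^sup>2 = 1"
proof -
  note * = ordered_matrix_prod_su11[where F = F and t = t and ns = "sorted_list_of_set {n. F n \<noteq> 0}", OF assms]
  show "su11_product F t = vector [vector [su11_a F t, su11_b F t],
           vector [cnj (su11_b F t), cnj (su11_a F t)]]"
    using * by (simp add: vec_eq_iff forall_2 su11_a_def su11_b_def su11_product_def)
  have "complex_of_real ((cmod (su11_a F t))\<^sup>2 - (cmod (su11_b F t))\<^sup>2) = 1"
    unfolding of_real_diff complex_norm_square su11_a_def su11_b_def su11_product_def
    using * by (metis det_2)
  then show "(cmod (su11_a F t))\<^sup>2 - (cmod (su11_b F t))\<^sup>2 = 1"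
    using of_real_eq_1_iff by blast
qed

lemma integrable_su11_a:
  assumes "\<And>n. cmod (F n) < 1" and "q > 0"
  shows "set_integrable lborel {0..<1} (\<lambda>t. norm (sqrt (ln ((cmod (su11_a F t))\<^sup>2))) powr q)"
proof -
  have ge: "(cmod (su11_a F t))\<^sup>2 \<ge> 1" for t
    using su11_product_in_SU11(2)[where F = F and t = t, OF assms(1)] zero_le_power2[of "cmod (su11_b F t)"]
    by linarith
  have ne: "su11_a F t \<noteq> 0" for t
    using ge[of t] by auto
  have "continuous_on {0..1} (su11_a F)"
    unfolding su11_a_def[abs_def] su11_product_def by (rule continuous_on_ordered_matrix_prod)
  then have "continuous_on {0..1} (\<lambda>t. norm (sqrt (ln ((cmod (su11_a F t))\<^sup>2))) powr q)"
    using ge ne \<open>q > 0\<close> by (intro continuous_on_powr' continuous_intros) auto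
  then have "set_integrable lborel {0..1} (\<lambda>t. norm (sqrt (ln ((cmod (su11_a F t))\<^sup>2))) powr q)"
    by (rule borel_integrable_atLeastAtMost')
  then show ?thesis
    by (rule set_integrable_subset) auto
qed

end

theory Submission
  imports Defs "HOL-Complex_Analysis.Conformal_Mappings"
begin

text \<open>
  Since \<open>|a|\<^sup>2 = 1 + |b|\<^sup>2\<close>, we have \<open>sqrt (log |a|\<^sup>2) \<le> |b|\<close>. Dividing the product by \<open>\<Prod>A\<^sub>n\<close>
  and unrolling the recursion twice writes the normalized \<open>b\<close> as the linear sum
  \<open>f = \<Sum>\<^sub>n F\<^sub>n e\<^sub>n\<close> plus \<open>\<Sum>\<^sub>j cnj (F\<^sub>j e\<^sub>j) \<beta>\<^sub>j f\<^sub>j\<close>, where \<open>f\<^sub>j\<close> is the part of \<open>f\<close> with frequencies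
  below \<open>j\<close> and \<open>\<beta>\<^sub>j\<close> is the normalized \<open>b\<close> of the factors beyond \<open>j\<close>, with \<open>|\<beta>\<^sub>j| \<le> exp s \<le> 2\<close> for
  \<open>s = \<parallel>F\<parallel>\<^sub>1 \<le> 1/2\<close>. The linear Hausdorff-Young inequality bounds \<open>f\<close> and every \<open>f\<^sub>j\<close> in \<open>L\<^sup>q\<close>
  by \<open>\<parallel>F\<parallel>\<^sub>p\<close>, so by convexity the norm of the normalized \<open>b\<close> is at most \<open>(1 + 2 s) \<parallel>F\<parallel>\<^sub>p\<close>; also
  \<open>\<Prod>A\<^sub>n \<le> (1 - s\<^sup>2)\<close> to the power \<open>-1/2\<close> and \<open>|F\<^sub>n|\<^sup>2 \<le> log A\<^sub>n\<^sup>2\<close>.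

  The linear inequality holds for averages over the translates of the \<open>N\<close>-th roots of unity, by
  interpolation between Plancherel and the trivial bound; averaging over the translates gives the
  integral without a limit.
\<close>

section \<open>Interpolation\<close>

text \<open>Three lines theorem, by a Gaussian regularization. The factor
  \<open>exp (e * (w^2 - 1))\<close> has modulus at most 1 on the strip, because \<open>Re w\<close>
  squared is at most 1 there, and it decays as \<open>Im w\<close> grows. So the maximum modulus
  principle on a tall rectangle around \<open>z\<close> applies, and then \<open>e\<close> tends to
  0.\<close>

lemma norm_le_1_on_strip:
  fixes G :: "complex \<Rightarrow> complex"
  assumes hol: "G holomorphic_on UNIV"
    and bdd: "\<And>z. 0 \<le> Re z \<Longrightarrow> Re z \<le> 1 \<Longrightarrow> cmod (G z) \<le> M"
    and left: "\<And>z. Re z = 0 \<Longrightarrow> cmod (G z) \<le> 1"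
    and right: "\<And>z. Re z = 1 \<Longrightarrow> cmod (G z) \<le> 1"
    and z: "0 \<le> Re z" "Re z \<le> 1"
  shows "cmod (G z) \<le> 1"
proof -
  have M0: "0 \<le> M"
    using bdd[OF z] norm_ge_zero order_trans by blast
  have *: "cmod (G z) * exp (e * ((Re z)\<^sup>2 - (Im z)\<^sup>2 - 1)) \<le> 1" if e: "e > 0" for e
  proof -
    define H where "H w = G w * exp (of_real e * (w\<^sup>2 - 1))" for w
    have normH: "cmod (H w) = cmod (G w) * exp (e * ((Re w)\<^sup>2 - (Im w)\<^sup>2 - 1))" for w
      by (simp add: H_def norm_mult power2_eq_square algebra_simps)
    \<comment> \<open>The first summand puts \<open>z\<close> into the rectangle. The other two give
      \<open>M \<le> e * T\<close> and \<open>1 \<le> T\<close>, which let the Gaussian factor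
      absorb \<open>M\<close> on the horizontal sides.\<close>
    define T where "T = \<bar>Im z\<bar> + M / e + 1"
    have T: "\<bar>Im z\<bar> \<le> T" "T \<ge> 1" "M \<le> e * T"
      using e M0 by (auto simp: T_def field_simps)
    have expT: "M * exp (- (e * T\<^sup>2)) \<le> 1"
    proof -
      have "M \<le> e * T" by fact
      also have "\<dots> \<le> e * T\<^sup>2" using T e by (simp add: power2_eq_square)
      also have "\<dots> \<le> exp (e * T\<^sup>2)" using exp_ge_add_one_self[of "e * T\<^sup>2"] by linarith
      finally show ?thesis by (simp add: exp_minus field_simps)
    qed
    let ?S = "cbox (Complex 0 (- T)) (Complex 1 T)"
    have holH: "H holomorphic_on UNIV"
      unfolding H_def using hol by (intro holomorphic_intros)
    have "cmod (H z) \<le> 1"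
    proof (rule maximum_modulus_frontier[where S = ?S and f = H and \<xi> = z])
      show "H holomorphic_on interior ?S" using holH holomorphic_on_subset by blast
      show "continuous_on (closure ?S) H"
        using holH holomorphic_on_imp_continuous_on continuous_on_subset by blast
      show "bounded ?S" by simp
      show "z \<in> ?S" using z T by (auto simp: in_cbox_complex_iff)
      fix w assume w: "w \<in> frontier ?S"
      then have "w \<in> ?S - box (Complex 0 (- T)) (Complex 1 T)"
        by (simp add: frontier_def)
      then have w01: "0 \<le> Re w" "Re w \<le> 1" and ImT: "\<bar>Im w\<bar> \<le> T"
        and cases: "Re w = 0 \<or> Re w = 1 \<or> \<bar>Im w\<bar> = T"
        by (auto simp: in_cbox_complex_iff in_box_complex_iff)
      have Re2: "(Re w)\<^sup>2 \<le> 1" using w01 by (simp add: power_le_one)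
      consider "Re w = 0 \<or> Re w = 1" | "\<bar>Im w\<bar> = T" using cases by blast
      then show "cmod (H w) \<le> 1"
      proof cases
        case 1
        then have "cmod (G w) \<le> 1" using left right by blast
        moreover have "exp (e * ((Re w)\<^sup>2 - (Im w)\<^sup>2 - 1)) \<le> 1"
          using Re2 e by (simp add: mult_le_0_iff) (smt (verit) zero_le_power2)
        ultimately show ?thesis unfolding normH
          by (simp add: mult_le_one)
      next
        case 2
        then have "(Im w)\<^sup>2 = T\<^sup>2" by (metis power2_abs)
        then have "e * ((Re w)\<^sup>2 - (Im w)\<^sup>2 - 1) \<le> - (e * T\<^sup>2)"
          using Re2 e by (simp add: algebra_simps)
        then have "cmod (G w) * exp (e * ((Re w)\<^sup>2 - (Im w)\<^sup>2 - 1)) \<le> M * exp (- (e * T\<^sup>2))"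
          using bdd[OF w01] M0 by (intro mult_mono) auto
        then show ?thesis unfolding normH using expT by linarith
      qed
    qed
    then show ?thesis by (simp add: normH)
  qed
  have "((\<lambda>e. cmod (G z) * exp (e * ((Re z)\<^sup>2 - (Im z)\<^sup>2 - 1))) \<longlongrightarrow>
      cmod (G z) * exp (0 * ((Re z)\<^sup>2 - (Im z)\<^sup>2 - 1))) (at_right 0)"
    by (intro tendsto_intros)
  then have "cmod (G z) * exp (0 * ((Re z)\<^sup>2 - (Im z)\<^sup>2 - 1)) \<le> 1"
    by (rule tendsto_upperbound) (auto simp: eventually_at_right_less intro!: eventually_at_right_less[THEN eventually_mono] *)
  then show ?thesis by simp
qed

text \<open>Dual form of interpolation between the measure space \<open>K\<close> with point mass
  \<open>w\<close> and counting measure on \<open>S\<close>. Both \<open>x\<close> and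
  \<open>y\<close> are put into analytic families. On one edge of the strip the pairing is
  controlled by \<open>L2\<close>, on the other by the pointwise bound \<open>E\<close>.\<close>

lemma Riesz_Thorin_l2_l1_bilinear:
  fixes E :: "'a \<Rightarrow> 'b \<Rightarrow> complex" and x :: "'a \<Rightarrow> complex" and y :: "'b \<Rightarrow> complex"
  assumes w: "0 < w" and p: "1 < p" "p < 2"
    and E: "\<And>n k. n \<in> S \<Longrightarrow> k \<in> K \<Longrightarrow> cmod (E n k) \<le> 1"
    and L2: "\<And>x. w * (\<Sum>k\<in>K. (cmod (\<Sum>n\<in>S. x n * E n k))\<^sup>2) \<le> (\<Sum>n\<in>S. (cmod (x n))\<^sup>2)"
    and x: "(\<Sum>n\<in>S. cmod (x n) powr p) \<le> 1"
    and y: "w * (\<Sum>k\<in>K. cmod (y k) powr p) \<le> 1"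
  shows "cmod (of_real w * (\<Sum>k\<in>K. y k * (\<Sum>n\<in>S. x n * E n k))) \<le> 1"
proof -
  \<comment> \<open>The extension has modulus \<open>|c|\<close> to the power \<open>p/2\<close> on \<open>Re z = 0\<close> (the \<open>\<ell>\<^sup>2\<close> endpoint) and \<open>p\<close>
    on \<open>Re z = 1\<close> (the \<open>\<ell>\<^sup>1\<close> endpoint), and it returns \<open>c\<close> itself at \<open>z = 2/p - 1\<close>.\<close>
  define ext where "ext c z = sgn c * of_real (cmod c) powr (of_real p * (1 + z) / 2)" for c z :: complex
  define G where "G z = of_real w * (\<Sum>k\<in>K. ext (y k) z * (\<Sum>n\<in>S. ext (x n) z * E n k))" for z
  have norm_ext: "cmod (ext c z) = cmod c powr (p * (1 + Re z) / 2)" for c z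
    by (auto simp: ext_def norm_mult norm_sgn norm_powr_real_powr)
  have ext_2: "(cmod (ext c z))\<^sup>2 = cmod c powr p" if "Re z = 0" for c z
    using that by (simp add: norm_ext power2_eq_square flip: powr_add)
  have ext_1: "cmod (ext c z) = cmod c powr p" if "Re z = 1" for c z
    using that by (simp add: norm_ext)
  \<comment> \<open>A crude bound, uniform on the strip: it only serves to show that
    \<open>G\<close> is bounded there, and the constant disappears in the three lines
    theorem.\<close>
  have ext_le: "cmod (ext c z) \<le> 1 + cmod c powr p" if "0 \<le> Re z" "Re z \<le> 1" for c z
  proof (cases "cmod c \<le> 1")
    case True
    then have "cmod c powr (p * (1 + Re z) / 2) \<le> 1"
      using that p by (intro powr_le1) auto
    then show ?thesis unfolding norm_ext by (smt (verit) powr_ge_zero)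
  next
    case False
    then have "cmod c powr (p * (1 + Re z) / 2) \<le> cmod c powr p"
      using that p by (intro powr_mono) auto
    then show ?thesis unfolding norm_ext by simp
  qed
  have ext_id: "ext c (of_real (2 / p - 1)) = c" for c
  proof -
    have "of_real p * (1 + of_real (2 / p - 1)) / 2 = (1::complex)"
      using p by (simp add: field_simps)
    moreover have "sgn c * of_real (cmod c) = c"
      by (cases "c = 0") (simp_all add: sgn_div_norm scaleR_conv_of_real)
    ultimately show ?thesis by (simp only: ext_def powr_to_1)
  qed
  have normG: "cmod (G z) \<le> w * (\<Sum>k\<in>K. cmod (ext (y k) z) * (\<Sum>n\<in>S. cmod (ext (x n) z)))" for z
  proof -
    have "cmod (\<Sum>n\<in>S. ext (x n) z * E n k) \<le> (\<Sum>n\<in>S. cmod (ext (x n) z))" if "k \<in> K" for k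
      using E that by (intro sum_norm_le) (simp add: norm_mult mult_left_le)
    then have "cmod (\<Sum>k\<in>K. ext (y k) z * (\<Sum>n\<in>S. ext (x n) z * E n k))
        \<le> (\<Sum>k\<in>K. cmod (ext (y k) z) * (\<Sum>n\<in>S. cmod (ext (x n) z)))"
      by (intro sum_norm_le) (simp add: norm_mult mult_left_mono)
    then show ?thesis using w by (simp add: G_def norm_mult)
  qed
  have "cmod (G (of_real (2 / p - 1))) \<le> 1"
  proof (rule norm_le_1_on_strip[where G = G and M =
      "w * (\<Sum>k\<in>K. (1 + cmod (y k) powr p) * (\<Sum>n\<in>S. 1 + cmod (x n) powr p))"])
    have "(\<lambda>z. of_real (cmod c) powr (of_real p * (1 + z) / 2)) holomorphic_on UNIV" for c :: complex
      by (intro holomorphic_intros) auto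
    then show "G holomorphic_on UNIV"
      unfolding G_def ext_def by (intro holomorphic_intros) auto
  next
    fix z assume "0 \<le> Re z" "Re z \<le> 1"
    note le = ext_le[OF this]
    have "w * (\<Sum>k\<in>K. cmod (ext (y k) z) * (\<Sum>n\<in>S. cmod (ext (x n) z)))
      \<le> w * (\<Sum>k\<in>K. (1 + cmod (y k) powr p) * (\<Sum>n\<in>S. 1 + cmod (x n) powr p))"
      using w le by (intro mult_left_mono sum_mono mult_mono sum_nonneg) auto
    then show "cmod (G z) \<le> w * (\<Sum>k\<in>K. (1 + cmod (y k) powr p) * (\<Sum>n\<in>S. 1 + cmod (x n) powr p))"
      using normG[of z] by linarith
  next
    fix z :: complex assume z: "Re z = 1"
    have "w * (\<Sum>k\<in>K. cmod (ext (y k) z) * (\<Sum>n\<in>S. cmod (ext (x n) z)))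
        = (w * (\<Sum>k\<in>K. cmod (y k) powr p)) * (\<Sum>n\<in>S. cmod (x n) powr p)"
      by (simp add: ext_1[OF z] sum_distrib_right mult.assoc)
    also have "\<dots> \<le> 1"
      using mult_le_one[OF y _ x] by (simp add: sum_nonneg)
    finally show "cmod (G z) \<le> 1" using normG[of z] by linarith
  next
    fix z :: complex assume z: "Re z = 0"
    let ?f = "\<lambda>k. \<Sum>n\<in>S. ext (x n) z * E n k"
    have f: "w * (\<Sum>k\<in>K. (cmod (?f k))\<^sup>2) \<le> 1"
      using L2[of "\<lambda>n. ext (x n) z"] x by (simp add: ext_2[OF z])
    \<comment> \<open>Both factors are normalized to 1, so the pointwise inequality between
      geometric and arithmetic mean does the work of Cauchy-Schwarz.\<close>
    have "cmod (\<Sum>k\<in>K. ext (y k) z * ?f k) \<le> (\<Sum>k\<in>K. (cmod (y k) powr p + (cmod (?f k))\<^sup>2) / 2)"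
    proof (rule sum_norm_le)
      fix k
      have "2 * (cmod (ext (y k) z) * cmod (?f k)) \<le> (cmod (ext (y k) z))\<^sup>2 + (cmod (?f k))\<^sup>2"
        using sum_squares_bound[of "cmod (ext (y k) z)" "cmod (?f k)"] by (simp add: mult.assoc)
      then show "cmod (ext (y k) z * ?f k) \<le> (cmod (y k) powr p + (cmod (?f k))\<^sup>2) / 2"
        by (simp add: norm_mult ext_2[OF z])
    qed
    then have "w * cmod (\<Sum>k\<in>K. ext (y k) z * ?f k) \<le> w * (\<Sum>k\<in>K. (cmod (y k) powr p + (cmod (?f k))\<^sup>2) / 2)"
      using w by (intro mult_left_mono) auto
    also have "\<dots> = (w * (\<Sum>k\<in>K. cmod (y k) powr p) + w * (\<Sum>k\<in>K. (cmod (?f k))\<^sup>2)) / 2"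
      by (simp add: sum.distrib algebra_simps flip: sum_divide_distrib)
    also have "\<dots> \<le> (1 + 1) / 2"
      using y f by (intro divide_right_mono add_mono) auto
    finally show "cmod (G z) \<le> 1" using w by (simp add: G_def norm_mult)
  qed (use p in \<open>auto simp: field_simps\<close>)
  then show ?thesis by (simp only: G_def ext_id)
qed

text \<open>Follows from the bilinear form by duality: normalize \<open>c\<close> and pair its
  transform with the function for which Hoelder's inequality is an equality.\<close>

lemma Riesz_Thorin_l2_l1:
  fixes E :: "'a \<Rightarrow> 'b \<Rightarrow> complex" and c :: "'a \<Rightarrow> complex"
  assumes S: "finite S" and w: "0 < w" and p: "1 < p" "p < 2"
    and pq: "1 / p + 1 / q = 1"
    and E: "\<And>n k. n \<in> S \<Longrightarrow> k \<in> K \<Longrightarrow> cmod (E n k) \<le> 1"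
    and L2: "\<And>x. w * (\<Sum>k\<in>K. (cmod (\<Sum>n\<in>S. x n * E n k))\<^sup>2) \<le> (\<Sum>n\<in>S. (cmod (x n))\<^sup>2)"
  shows "w * (\<Sum>k\<in>K. cmod (\<Sum>n\<in>S. c n * E n k) powr q) \<le> (\<Sum>n\<in>S. cmod (c n) powr p) powr (q / p)"
proof -
  define f where "f k = (\<Sum>n\<in>S. c n * E n k)" for k
  define I where "I = w * (\<Sum>k\<in>K. cmod (f k) powr q)"
  define C where "C = (\<Sum>n\<in>S. cmod (c n) powr p)"
  have "1 / p < 1" using p by simp
  then have "0 < 1 / q" using pq by linarith
  then have q0: "q > 0" by (simp only: zero_less_divide_1_iff)
  have qp: "(q - 1) * p = q" "1 - 1 / p = 1 / q"
    using pq p q0 by (simp_all add: field_simps)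
  have I0: "I \<ge> 0" using w by (simp add: I_def sum_nonneg)
  have C0: "C \<ge> 0" by (simp add: C_def sum_nonneg)
  have "I \<le> C powr (q / p)"
  proof (cases "I = 0 \<or> C = 0")
    case True
    moreover have "I = 0" if "C = 0"
    proof -
      have "c n = 0" if "n \<in> S" for n
        using \<open>C = 0\<close> that S unfolding C_def by (subst (asm) sum_nonneg_eq_0_iff) auto
      then show ?thesis by (simp add: I_def f_def)
    qed
    ultimately show ?thesis by auto
  next
    case False
    then have pos: "I > 0" "C > 0" using I0 C0 by auto
    define x where "x n = c n / of_real (C powr (1 / p))" for n
    \<comment> \<open>The Hoelder extremizer for \<open>f\<close>. Since
      \<open>(q - 1) * p = q\<close>, its weighted \<open>p\<close>-norm is 1, and its weighted
      pairing with \<open>f\<close> is \<open>I powr (1 / q)\<close>.\<close>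
    define y where "y k = cnj (sgn (f k)) * of_real (cmod (f k) powr (q - 1) / I powr (1 / p))" for k
    have "(\<Sum>n\<in>S. cmod (x n) powr p) = C / C"
      unfolding x_def using pos p
      by (simp add: norm_divide powr_divide powr_powr C_def flip: sum_divide_distrib)
    then have x: "(\<Sum>n\<in>S. cmod (x n) powr p) \<le> 1" by simp
    have "cmod (y k) powr p = cmod (f k) powr q / I" for k
      unfolding y_def using pos p
      by (auto simp: norm_mult norm_divide norm_sgn powr_divide powr_mult powr_powr qp)
    then have "w * (\<Sum>k\<in>K. cmod (y k) powr p) = I / I"
      by (simp add: I_def flip: sum_divide_distrib)
    then have y: "w * (\<Sum>k\<in>K. cmod (y k) powr p) \<le> 1" by simp
    have yf: "y k * f k = of_real (cmod (f k) powr q / I powr (1 / p))" for k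
    proof (cases "f k = 0")
      case False
      have "cnj (sgn (f k)) * f k = of_real (cmod (f k))"
        using False by (simp add: sgn_div_norm scaleR_conv_of_real mult.assoc)
          (simp add: complex_norm_square[symmetric] mult.commute power2_eq_square field_simps)
      moreover have "cmod (f k) powr (q - 1) * cmod (f k) = cmod (f k) powr q"
        using False by (metis diff_add_cancel norm_ge_zero powr_add powr_one)
      ultimately show ?thesis unfolding y_def
        by (smt (verit) mult.assoc mult.commute of_real_mult times_divide_eq_left)
    qed (simp add: y_def)
    have "(\<Sum>n\<in>S. x n * E n k) = f k / of_real (C powr (1 / p))" for k
      by (simp add: x_def f_def sum_divide_distrib)
    then have "of_real w * (\<Sum>k\<in>K. y k * (\<Sum>n\<in>S. x n * E n k))
        = of_real w * (\<Sum>k\<in>K. y k * f k) / of_real (C powr (1 / p))"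
      by (simp flip: sum_divide_distrib)
    also have "\<dots> = of_real (I / I powr (1 / p) / C powr (1 / p))"
      by (simp add: yf I_def flip: sum_divide_distrib)
    also have "I / I powr (1 / p) = I powr (1 / q)"
      using pos by (simp add: powr_diff flip: qp(2))
    finally have "cmod (of_real (I powr (1 / q) / C powr (1 / p))) \<le> 1"
      using Riesz_Thorin_l2_l1_bilinear[OF w p E L2 x y] by simp
    then have "I powr (1 / q) \<le> C powr (1 / p)"
      using pos by (simp add: norm_divide)
    then have "(I powr (1 / q)) powr q \<le> (C powr (1 / p)) powr q"
      using q0 by (intro powr_mono2) auto
    then show ?thesis using pos q0 by (simp add: powr_powr)
  qed
  then show ?thesis by (simp add: I_def f_def C_def)
qed

section \<open>The Hausdorff-Young inequality for trigonometric polynomials\<close>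

lemma sum_cis_roots_of_unity:
  fixes m :: int and N :: nat
  assumes N: "0 < N" and m: "\<not> int N dvd m"
  shows "(\<Sum>k<N. cis (2 * pi * of_int m * (real k / real N))) = 0"
proof -
  define z where "z = cis (2 * pi * of_int m / real N)"
  have "z \<noteq> 1"
  proof
    assume "z = 1"
    then have "cos (2 * pi * of_int m / real N) = 1"
      by (simp add: z_def complex_eq_iff)
    then obtain j :: int where "2 * pi * of_int m / real N = of_int j * (2 * pi)"
      by (auto simp: cos_one_2pi_int)
    then have "(of_int m :: real) = of_int (j * int N)"
      using N by (simp add: field_simps)
    then have "m = j * int N" by (simp only: of_int_eq_iff)
    then show False using m by simp
  qed
  moreover have "z ^ N = 1"
  proof -
    have "real N * (2 * pi * of_int m / real N) = 2 * pi * of_int m" using N by simp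
    then have "z ^ N = cis (2 * pi * of_int m)" by (simp only: z_def Complex.DeMoivre)
    then show ?thesis by (simp add: cis_multiple_2pi)
  qed
  moreover have "cis (2 * pi * of_int m * (real k / real N)) = z ^ k" for k
    by (simp add: z_def Complex.DeMoivre field_simps)
  ultimately show ?thesis by (simp add: geometric_sum)
qed

text \<open>Frequencies that are distinct modulo \<open>N\<close> give orthogonal characters on the
  \<open>N\<close>-th roots of unity. The translation by \<open>u\<close> multiplies the cross terms
  by unimodular factors, which are 1 on the diagonal.\<close>

lemma discrete_Plancherel:
  fixes S :: "int set" and x :: "int \<Rightarrow> complex" and u :: real
  assumes S: "finite S" and N: "0 < N"
    and inj: "\<And>m n. m \<in> S \<Longrightarrow> n \<in> S \<Longrightarrow> int N dvd n - m \<Longrightarrow> m = n"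
  shows "(1 / real N) * (\<Sum>k<N. (cmod (\<Sum>n\<in>S. x n * cis (2 * pi * of_int n * (u + real k / real N))))\<^sup>2)
    = (\<Sum>n\<in>S. (cmod (x n))\<^sup>2)"
proof -
  let ?e = "\<lambda>n v. cis (2 * pi * of_int n * v)"
  have e: "?e n (u + v) * cnj (?e m (u + v)) = ?e (n - m) u * ?e (n - m) v" for n m v
    by (simp add: cis_cnj cis_mult algebra_simps)
  have "complex_of_real (\<Sum>k<N. (cmod (\<Sum>n\<in>S. x n * ?e n (u + real k / real N)))\<^sup>2) =
      (\<Sum>k<N. \<Sum>n\<in>S. \<Sum>m\<in>S. (x n * cnj (x m) * ?e (n - m) u) * ?e (n - m) (real k / real N))"
    unfolding of_real_sum complex_norm_square cnj_sum sum_product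
  proof (intro sum.cong refl)
    fix k n m
    let ?v = "real k / real N"
    show "x n * ?e n (u + ?v) * cnj (x m * ?e m (u + ?v)) =
        x n * cnj (x m) * ?e (n - m) u * ?e (n - m) ?v"
      using e[of n ?v m] unfolding complex_cnj_mult by (metis (no_types, lifting) mult.assoc mult.left_commute)
  qed
  also have "\<dots> = (\<Sum>n\<in>S. \<Sum>m\<in>S. (x n * cnj (x m) * ?e (n - m) u) * (\<Sum>k<N. ?e (n - m) (real k / real N)))"
    unfolding sum_distrib_left
    by (subst sum.swap, intro sum.cong refl, subst sum.swap) simp
  also have "\<dots> = (\<Sum>n\<in>S. \<Sum>m\<in>S. if m = n then of_nat N * of_real ((cmod (x n))\<^sup>2) else 0)"
  proof (intro sum.cong refl)
    fix n m assume "n \<in> S" "m \<in> S"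
    show "(x n * cnj (x m) * ?e (n - m) u) * (\<Sum>k<N. ?e (n - m) (real k / real N)) =
        (if m = n then of_nat N * of_real ((cmod (x n))\<^sup>2) else 0)"
    proof (cases "m = n")
      case True
      then show ?thesis by (simp only: complex_norm_square) simp
    next
      case False
      then have "\<not> int N dvd n - m" using inj \<open>n \<in> S\<close> \<open>m \<in> S\<close> by blast
      then show ?thesis using False sum_cis_roots_of_unity[OF N, of "n - m"] by simp
    qed
  qed
  also have "\<dots> = of_real (real N * (\<Sum>n\<in>S. (cmod (x n))\<^sup>2))"
    using S by (simp add: sum_distrib_left)
  finally show ?thesis using N unfolding of_real_eq_iff by simp
qed

text \<open>Cutting the unit interval into \<open>N\<close> equal pieces turns the integral into one
  over a single piece of the sum of the translates. The mean value theorem then picks one shift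
  whose average is the integral.\<close>

lemma integral_le_of_average_shifts_le:
  fixes h :: "real \<Rightarrow> real"
  assumes h: "continuous_on UNIV h" and N: "0 < N"
    and le: "\<And>u. (1 / real N) * (\<Sum>k<N. h (u + real k / real N)) \<le> C"
  shows "integral {0..1} h \<le> C"
proof -
  \<comment> \<open>The larger interval makes \<open>[0, 1]\<close> interior, so that
    \<open>H\<close> has two-sided derivatives at 0 and 1 as well.\<close>
  obtain H where H: "\<And>x. x \<in> {-1..2} \<Longrightarrow> (H has_vector_derivative h x) (at x within {-1..2})"
    using antiderivative_continuous[of "-1" 2 h] continuous_on_subset[OF h] by blast
  have dH: "(H has_real_derivative h x) (at x)" if "0 \<le> x" "x \<le> 1" for x
    using H[of x] that at_within_interior[of x "{-1..2}"]
    by (simp add: has_real_derivative_iff_has_vector_derivative)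
  have "(h has_integral (H 1 - H 0)) {0..1}"
    using dH by (intro fundamental_theorem_of_calculus)
      (auto simp flip: has_real_derivative_iff_has_vector_derivative intro: has_field_derivative_at_within)
  then have int: "integral {0..1} h = H 1 - H 0" by (rule integral_unique)
  \<comment> \<open>\<open>\<Phi> (1/N) - \<Phi> 0\<close> telescopes to the integral, and \<open>\<Phi>'\<close> is \<open>N\<close> times an average.\<close>
  define \<Phi> where "\<Phi> x = (\<Sum>k<N. H (x + real k / real N))" for x
  have d\<Phi>: "(\<Phi> has_real_derivative (\<Sum>k<N. h (x + real k / real N))) (at x)"
    if "0 \<le> x" "x \<le> 1 / real N" for x
    unfolding \<Phi>_def
  proof (rule DERIV_sum)
    fix k assume "k \<in> {..<N}"
    then have "real k + 1 \<le> real N" by simp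
    then have "x + real k / real N \<le> 1" using that N by (simp add: field_simps)
    moreover have "0 \<le> x + real k / real N" using that by simp
    ultimately have "(H has_real_derivative h (x + real k / real N)) (at (x + real k / real N))"
      using dH by blast
    then show "((\<lambda>x. H (x + real k / real N)) has_real_derivative h (x + real k / real N)) (at x)"
      by (simp add: DERIV_shift)
  qed
  obtain y where y: "\<Phi> (1 / real N) - \<Phi> 0 = (1 / real N - 0) * (\<Sum>k<N. h (y + real k / real N))"
    using MVT2[of 0 "1 / real N" \<Phi> "\<lambda>x. \<Sum>k<N. h (x + real k / real N)"] d\<Phi> N by auto
  have "\<Phi> (1 / real N) - \<Phi> 0 = (\<Sum>k<N. H (real (Suc k) / real N) - H (real k / real N))"
    by (simp add: \<Phi>_def sum_subtractf add_divide_distrib)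
  also have "\<dots> = H 1 - H 0"
    using N by (subst sum_lessThan_telescope) auto
  finally show ?thesis using le[of y] y int by simp
qed

lemma continuous_on_trig_poly_powr:
  fixes c :: "int \<Rightarrow> complex"
  assumes "q > 0"
  shows "continuous_on T (\<lambda>t. cmod (\<Sum>n\<in>S. c n * cis (2 * pi * of_int n * t)) powr q)"
  using assms by (intro continuous_on_powr' continuous_intros) (auto simp: cis_conv_exp intro!: continuous_intros)

lemma set_integrable_trig_poly_powr:
  fixes c :: "int \<Rightarrow> complex"
  assumes "q > 0"
  shows "set_integrable lborel {0..<1} (\<lambda>t. cmod (\<Sum>n\<in>S. c n * cis (2 * pi * of_int n * t)) powr q)"
  by (rule set_integrable_subset[OF borel_integrable_atLeastAtMost'[OF continuous_on_trig_poly_powr[OF assms], of 0 1]]) auto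

text \<open>For large \<open>N\<close> the characters sampled at \<open>u + k / N\<close>, with
  weight \<open>1 / N\<close>, satisfy the hypotheses of the interpolation lemma. The resulting
  bound does not depend on \<open>u\<close>, so it passes to the integral.\<close>

theorem Hausdorff_Young_trig_poly:
  fixes c :: "int \<Rightarrow> complex"
  assumes S: "finite S" and p: "1 < p" "p < 2" and pq: "1 / p + 1 / q = 1"
  shows "(LINT t:{0..<1}|lborel. cmod (\<Sum>n\<in>S. c n * cis (2 * pi * of_int n * t)) powr q)
    \<le> (\<Sum>n\<in>S. cmod (c n) powr p) powr (q / p)"
proof -
  define h where "h t = cmod (\<Sum>n\<in>S. c n * cis (2 * pi * of_int n * t)) powr q" for t
  have "1 / p < 1" using p by simp
  then have "0 < 1 / q" using pq by linarith
  then have q: "q > 0" by (simp only: zero_less_divide_1_iff)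
  obtain M where M: "\<And>n. n \<in> S \<Longrightarrow> \<bar>n\<bar> \<le> M"
    using S bdd_above_finite[of "abs ` S"] by (auto simp: bdd_above_def)
  \<comment> \<open>Two frequencies differ by at most \<open>2 * M\<close>, so this \<open>N\<close>
    separates them modulo \<open>N\<close>. The absolute value keeps \<open>N\<close> positive even
    if \<open>S\<close> is empty and \<open>M\<close> negative.\<close>
  define N where "N = nat (2 * \<bar>M\<bar> + 1)"
  have N: "0 < N" by (simp add: N_def)
  have inj: "m = n" if "m \<in> S" "n \<in> S" "int N dvd n - m" for m n
  proof (rule ccontr)
    assume "m \<noteq> n"
    then have "int N \<le> \<bar>n - m\<bar>" using zdvd_imp_le[of "int N" "\<bar>n - m\<bar>"] that by simp
    then show False using M[OF \<open>m \<in> S\<close>] M[OF \<open>n \<in> S\<close>] by (simp add: N_def)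
  qed
  have "integral {0..1} h \<le> (\<Sum>n\<in>S. cmod (c n) powr p) powr (q / p)"
  proof (rule integral_le_of_average_shifts_le[OF _ N])
    show "continuous_on UNIV h" unfolding h_def by (rule continuous_on_trig_poly_powr[OF q])
    show "1 / real N * (\<Sum>k<N. h (u + real k / real N)) \<le> (\<Sum>n\<in>S. cmod (c n) powr p) powr (q / p)" for u
      unfolding h_def using N discrete_Plancherel[OF S N inj]
      by (intro Riesz_Thorin_l2_l1[OF S _ p pq]) auto
  qed
  moreover have "(LINT t:{0..<1}|lborel. h t) = (LINT t:{0..1}|lborel. h t)"
    by (rule set_integral_discrete_difference[where X = "{1}"]) auto
  moreover have "(LINT t:{0..1}|lborel. h t) = integral {0..1} h"
    unfolding h_def
    by (intro set_borel_integral_eq_integral borel_integrable_atLeastAtMost' continuous_on_trig_poly_powr q)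
  ultimately show ?thesis by (simp add: h_def)
qed

section \<open>The normalized product\<close>

text \<open>First row of the product of the matrices with rows \<open>(1, z)\<close> and \<open>(cnj z, 1)\<close>.\<close>

fun reduced_a :: "complex list \<Rightarrow> complex" and reduced_b :: "complex list \<Rightarrow> complex" where
  "reduced_a [] = 1"
| "reduced_b [] = 0"
| "reduced_a (z # zs) = reduced_a zs + z * cnj (reduced_b zs)"
| "reduced_b (z # zs) = reduced_b zs + z * cnj (reduced_a zs)"

text \<open>Since \<open>coeff_B F n\<close> is \<open>coeff_A F n\<close> times \<open>F n\<close>,
  each factor releases the scalar \<open>coeff_A F n\<close>. The symmetry of the second row closes
  the recursion on the first row alone.\<close>

lemma ordered_matrix_prod_eq_reduced:
  assumes F: "\<And>n. cmod (F n) < 1"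
  shows "ordered_matrix_prod (su11_factor F t) ns $ 1 $ 1 =
      of_real (prod_list (map (coeff_A F) ns)) * reduced_a (map (\<lambda>n. F n * cis (2 * pi * of_int n * t)) ns)"
    and "ordered_matrix_prod (su11_factor F t) ns $ 1 $ 2 =
      of_real (prod_list (map (coeff_A F) ns)) * reduced_b (map (\<lambda>n. F n * cis (2 * pi * of_int n * t)) ns)"
proof (induction ns)
  case (Cons n ns)
  let ?P = "ordered_matrix_prod (su11_factor F t) ns"
  have B: "coeff_B F n = of_real (coeff_A F n) * F n"
    by (simp add: coeff_A_def coeff_B_def)
  have P: "ordered_matrix_prod (su11_factor F t) (n # ns) = su11_factor F t n ** ?P"
    by (simp add: ordered_matrix_prod_def)
  note bottom = ordered_matrix_prod_su11[where F = F and t = t and ns = ns, OF F]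
  { case 1
    show ?case
      unfolding P using bottom
      by (simp add: matrix_matrix_mult_def sum_2 su11_factor_def B Cons.IH algebra_simps) }
  { case 2
    show ?case
      unfolding P using bottom
      by (simp add: matrix_matrix_mult_def sum_2 su11_factor_def B Cons.IH algebra_simps) }
qed (simp_all add: ordered_matrix_prod_def mat_def)

text \<open>Prepending \<open>z\<close> increases the sum of the two moduli by a factor of at most
  \<open>1 + cmod z\<close>, hence of at most \<open>exp (cmod z)\<close>.\<close>

lemma norm_reduced_le:
  "cmod (reduced_a zs) + cmod (reduced_b zs) \<le> exp (sum_list (map cmod zs))"
proof (induction zs)
  case (Cons z zs)
  have "cmod (reduced_a (z # zs)) \<le> cmod (reduced_a zs) + cmod z * cmod (reduced_b zs)"
    using norm_triangle_ineq[of "reduced_a zs" "z * cnj (reduced_b zs)"] by (simp add: norm_mult)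
  moreover have "cmod (reduced_b (z # zs)) \<le> cmod (reduced_b zs) + cmod z * cmod (reduced_a zs)"
    using norm_triangle_ineq[of "reduced_b zs" "z * cnj (reduced_a zs)"] by (simp add: norm_mult)
  ultimately have "cmod (reduced_a (z # zs)) + cmod (reduced_b (z # zs))
      \<le> (1 + cmod z) * (cmod (reduced_a zs) + cmod (reduced_b zs))"
    by (simp add: algebra_simps)
  also have "\<dots> \<le> exp (cmod z) * exp (sum_list (map cmod zs))"
    using Cons by (intro mult_mono exp_ge_add_one_self) auto
  finally show ?case by (simp add: exp_add)
qed simp

text \<open>The variable \<open>g\<close> collects the sum of the entries that an induction has already passed.\<close>

lemma norm_reduced_b_le_aux:
  assumes "exp (sum_list (map cmod zs)) \<le> R"
  shows "cmod (reduced_b zs + g * cnj (reduced_a zs)) \<le>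
    cmod (g + sum_list zs) + (\<Sum>i<length zs. R * cmod (zs ! i) * cmod (g + sum_list (take i zs)))"
  using assms
proof (induction zs arbitrary: g)
  case (Cons z zs)
  have "exp (sum_list (map cmod zs)) \<le> exp (sum_list (map cmod (z # zs)))" by simp
  then have R: "exp (sum_list (map cmod zs)) \<le> R" using Cons.prems by linarith
  \<comment> \<open>Unrolling both recursions moves \<open>z\<close> into the accumulator. The
    leftover term, with \<open>reduced_b zs\<close> bounded by \<open>R\<close>, is the summand
    \<open>i = 0\<close>; the summands of the induction hypothesis shift up by one.\<close>
  have "reduced_b (z # zs) + g * cnj (reduced_a (z # zs)) =
      (reduced_b zs + (g + z) * cnj (reduced_a zs)) + g * cnj z * reduced_b zs"
    by (simp add: algebra_simps)
  then have "cmod (reduced_b (z # zs) + g * cnj (reduced_a (z # zs))) \<le>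
      cmod (reduced_b zs + (g + z) * cnj (reduced_a zs)) + cmod g * cmod z * cmod (reduced_b zs)"
    by (metis norm_triangle_ineq norm_mult complex_mod_cnj)
  also have "\<dots> \<le> (cmod (g + z + sum_list zs)
        + (\<Sum>i<length zs. R * cmod (zs ! i) * cmod (g + z + sum_list (take i zs)))) + cmod g * cmod z * R"
  proof (intro add_mono Cons.IH R mult_left_mono)
    show "cmod (reduced_b zs) \<le> R"
      using norm_reduced_le[of zs] R norm_ge_zero[of "reduced_a zs"] by linarith
  qed simp
  finally show ?case
    unfolding length_Cons sum.lessThan_Suc_shift by (simp add: algebra_simps)
qed simp

lemma norm_reduced_b_le:
  assumes "exp (sum_list (map cmod zs)) \<le> R"
  shows "cmod (reduced_b zs) \<le>
    cmod (sum_list zs) + (\<Sum>i<length zs. R * cmod (zs ! i) * cmod (sum_list (take i zs)))"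
  using norm_reduced_b_le_aux[OF assms, of 0] by simp

section \<open>Estimates for the constants, and convexity\<close>

text \<open>By the Weierstrass product inequality the product of \<open>1 - |F n|^2\<close> is at
  least 1 minus the sum of squares, and that sum is at most the square of the l1 norm.\<close>

lemma prod_coeff_A_le:
  assumes F: "\<And>n. cmod (F n) < 1" and S: "finite S" and s: "(\<Sum>n\<in>S. cmod (F n)) < 1"
  shows "prod (coeff_A F) S \<le> 1 / sqrt (1 - (\<Sum>n\<in>S. cmod (F n))\<^sup>2)"
proof -
  let ?s = "\<Sum>n\<in>S. cmod (F n)"
  have s0: "0 \<le> ?s" by (simp add: sum_nonneg)
  have "sqrt (\<Sum>n\<in>S. (cmod (F n))\<^sup>2) \<le> ?s"
    using L2_set_le_sum[of S "\<lambda>n. cmod (F n)"] by (simp add: L2_set_def)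
  then have "(\<Sum>n\<in>S. (cmod (F n))\<^sup>2) \<le> ?s\<^sup>2"
    using s0 by (simp add: real_sqrt_le_iff sqrt_le_D)
  moreover have "1 - (\<Sum>n\<in>S. (cmod (F n))\<^sup>2) \<le> (\<Prod>n\<in>S. 1 - (cmod (F n))\<^sup>2)"
    using F by (intro Weierstrass_prod_ineq) (auto simp: power_le_one less_imp_le)
  ultimately have "1 - ?s\<^sup>2 \<le> (\<Prod>n\<in>S. 1 - (cmod (F n))\<^sup>2)" by linarith
  moreover have "prod (coeff_A F) S = 1 / sqrt (\<Prod>n\<in>S. 1 - (cmod (F n))\<^sup>2)"
    using S by induction (simp_all add: coeff_A_def real_sqrt_mult)
  moreover have "0 < 1 - ?s\<^sup>2"
    using s s0 by (simp add: power_less_one_iff abs_square_less_1)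
  ultimately show ?thesis by (simp add: frac_le)
qed

text \<open>Jensen's inequality for the power \<open>q\<close> with total weight \<open>W\<close>.
  Young's inequality against \<open>m powr (q - 1)\<close>, an equality at \<open>x i = m\<close>,
  plays the role of the tangent line at the mean \<open>m\<close>.\<close>

lemma weighted_power_mean:
  fixes w x :: "'a \<Rightarrow> real"
  assumes w: "\<And>i. i \<in> I \<Longrightarrow> 0 \<le> w i" and x: "\<And>i. i \<in> I \<Longrightarrow> 0 \<le> x i" and q: "1 < q"
  shows "(\<Sum>i\<in>I. w i * x i) powr q \<le> (\<Sum>i\<in>I. w i) powr (q - 1) * (\<Sum>i\<in>I. w i * x i powr q)"
proof (cases "(\<Sum>i\<in>I. w i * x i) = 0")
  case True
  then show ?thesis using w by (simp add: sum_nonneg)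
next
  case False
  define W where "W = (\<Sum>i\<in>I. w i)"
  define m where "m = (\<Sum>i\<in>I. w i * x i) / W"
  have "0 \<le> W" using w by (simp add: W_def sum_nonneg)
  moreover have "W \<noteq> 0"
  proof
    assume "W = 0"
    then have "\<forall>i\<in>I. w i = 0"
      using False w by (subst (asm) W_def, subst (asm) sum_nonneg_eq_0_iff) (auto intro: ccontr)
    then show False using False by simp
  qed
  ultimately have W: "W > 0" by simp
  have "0 \<le> (\<Sum>i\<in>I. w i * x i)" using w x by (simp add: sum_nonneg)
  then have m: "m > 0" using False W by (simp add: m_def)
  have Wm: "(\<Sum>i\<in>I. w i * x i) = W * m" using W by (simp add: m_def)
  define r where "r = q / (q - 1)"
  have r: "r > 1" "1 / q + 1 / r = 1" "(q - 1) * r = q" "1 / r = 1 - 1 / q"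
    using q by (simp_all add: r_def field_simps)
  have young: "x i * m powr (q - 1) \<le> x i powr q / q + m powr q / r" if "i \<in> I" for i
    using Youngs_inequality[OF q r(1,2) x[OF that], of "m powr (q - 1)"] by (simp add: powr_powr r(3))
  have mq: "m powr q = m * m powr (q - 1)"
    using m by (simp add: powr_mult_base)
  have "W * m powr q = (\<Sum>i\<in>I. w i * (x i * m powr (q - 1)))"
    by (simp add: mq Wm mult.assoc flip: sum_distrib_right Wm) (simp add: Wm flip: mult.assoc sum_distrib_right)
  also have "\<dots> \<le> (\<Sum>i\<in>I. w i * (x i powr q / q + m powr q / r))"
    using w young by (intro sum_mono mult_left_mono) auto
  also have "\<dots> = (\<Sum>i\<in>I. w i * x i powr q) / q + W * m powr q / r"
    by (simp add: W_def distrib_left sum.distrib sum_distrib_right sum_divide_distrib)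
  also have "W * m powr q / r = W * m powr q - W * m powr q / q"
    using arg_cong[OF r(4), of "\<lambda>u. W * m powr q * u"] by (simp add: right_diff_distrib)
  finally have "W * m powr q / q \<le> (\<Sum>i\<in>I. w i * x i powr q) / q" by simp
  then have "W * m powr q \<le> (\<Sum>i\<in>I. w i * x i powr q)"
    using q by (simp add: divide_le_cancel)
  then have "W powr (q - 1) * (W * m powr q) \<le> W powr (q - 1) * (\<Sum>i\<in>I. w i * x i powr q)"
    by (intro mult_left_mono) auto
  moreover have "W powr (q - 1) * (W * m powr q) = (W * m) powr q"
    using W m by (simp add: powr_mult powr_diff)
  ultimately show ?thesis by (simp add: Wm W_def)
qed

text \<open>Merges the normalizing factor and the factor \<open>1 + 2 * s\<close> of the
  perturbation into the constant of the theorem. After squaring, the difference is \<open>s\<close>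
  times a cubic that is at least \<open>2 - 5 * s / 4\<close> on the given range.\<close>

lemma inverse_sqrt_times_le:
  fixes s :: real
  assumes "0 \<le> s" "s \<le> 1 / 2"
  shows "1 / sqrt (1 - s\<^sup>2) * (1 + 2 * s) \<le> 1 + 3 * s"
proof -
  have s2: "s\<^sup>2 \<le> 1 / 4" using power_mono[OF assms(2,1), of 2] by (simp add: power2_eq_square)
  have "s ^ 3 \<le> 1 / 4 * s" using s2 assms mult_right_mono[of "s\<^sup>2" "1/4" s]
    by (simp add: power2_eq_square power3_eq_cube)
  have "s\<^sup>2 \<le> s / 2" using assms mult_left_mono[of s "1/2" s] by (simp add: power2_eq_square)
  have "(1 + 2 * s)\<^sup>2 \<le> (1 + 3 * s)\<^sup>2 * (1 - s\<^sup>2)"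
  proof -
    have "(1 + 3 * s)\<^sup>2 * (1 - s\<^sup>2) - (1 + 2 * s)\<^sup>2 = s * (2 + 4 * s - 6 * s\<^sup>2 - 9 * s ^ 3)"
      by (simp add: power2_eq_square power3_eq_cube algebra_simps)
    moreover have "2 + 4 * s - 6 * s\<^sup>2 - 9 * s ^ 3 \<ge> 0"
      using \<open>s ^ 3 \<le> 1 / 4 * s\<close> \<open>s\<^sup>2 \<le> s / 2\<close> assms by linarith
    ultimately show ?thesis using assms by (smt (verit) mult_nonneg_nonneg)
  qed
  then have "1 + 2 * s \<le> sqrt ((1 + 3 * s)\<^sup>2 * (1 - s\<^sup>2))"
    by (rule real_le_rsqrt)
  also have "\<dots> = (1 + 3 * s) * sqrt (1 - s\<^sup>2)"
    using assms by (simp add: real_sqrt_mult)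
  finally show ?thesis using s2 by (simp add: divide_le_eq)
qed

lemma
  fixes f :: "'i \<Rightarrow> 'a \<Rightarrow> 'b::{banach, second_countable_topology}"
  assumes "\<And>i. i \<in> I \<Longrightarrow> set_integrable M A (f i)"
  shows set_integrable_sum: "set_integrable M A (\<lambda>x. \<Sum>i\<in>I. f i x)"
    and set_integral_sum: "(LINT x:A|M. \<Sum>i\<in>I. f i x) = (\<Sum>i\<in>I. LINT x:A|M. f i x)"
  using assms unfolding set_integrable_def set_lebesgue_integral_def scaleR_sum_right
  by (simp_all add: Bochner_Integration.integral_sum)

theorem theorem1:
  fixes p q :: real and F :: "int \<Rightarrow> complex"
  assumes "1 < p" and "p < 2" and "2 < q" and "1 / p + 1 / q = 1"
    and "\<And>n. cmod (F n) < 1"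
    and "finite {n. F n \<noteq> 0}"
    and "lp_norm 1 F \<le> 1 / 2"
  shows "Lq_norm q (\<lambda>t. sqrt (ln ((cmod (su11_a F t))\<^sup>2)))
           \<le> (1 + 3 * lp_norm 1 F) * lp_norm p (\<lambda>n. sqrt (ln (\<bar>coeff_A F n\<bar>\<^sup>2)))"
proof -
  note F = assms(5) and q = assms(3)

  \<comment> \<open>Constants and comparison of the coefficient norms\<close>
  define S where "S = {n. F n \<noteq> 0}"
  define s where "s = lp_norm 1 F"
  define P where "P = prod (coeff_A F) S"
  define C where "C = (\<Sum>n\<in>S. cmod (F n) powr p)"
  have S: "finite S" using assms(6) by (simp add: S_def)
  have s: "s = (\<Sum>n\<in>S. cmod (F n))"
  proof -
    have "(\<Sum>\<^sub>\<infinity>n. norm (F n) powr 1) = (\<Sum>\<^sub>\<infinity>n\<in>S. norm (F n) powr 1)"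
      by (rule infsum_cong_neutral) (auto simp: S_def)
    also have "\<dots> = (\<Sum>n\<in>S. cmod (F n))" using S by simp
    finally show ?thesis by (simp add: s_def lp_norm_def sum_nonneg)
  qed
  have s01: "0 \<le> s" "s \<le> 1 / 2" using assms(7) by (simp_all add: s sum_nonneg flip: s_def)
  have C0: "C \<ge> 0" by (simp add: C_def sum_nonneg)
  have A1: "1 \<le> coeff_A F n" and A2: "ln (\<bar>coeff_A F n\<bar>\<^sup>2) \<ge> (cmod (F n))\<^sup>2" for n
  proof -
    have pos: "1 - (cmod (F n))\<^sup>2 > 0" using F[of n] by (simp add: power_less_one_iff abs_square_less_1)
    then show "1 \<le> coeff_A F n" by (simp add: coeff_A_def)
    have "\<bar>coeff_A F n\<bar>\<^sup>2 = inverse (1 - (cmod (F n))\<^sup>2)"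
      using pos by (simp add: coeff_A_def power_divide divide_inverse power_inverse)
    then have "ln (\<bar>coeff_A F n\<bar>\<^sup>2) = - ln (1 - (cmod (F n))\<^sup>2)"
      using pos by (simp add: ln_inverse)
    then show "ln (\<bar>coeff_A F n\<bar>\<^sup>2) \<ge> (cmod (F n))\<^sup>2"
      using ln_add_one_self_le_self2[of "- (cmod (F n))\<^sup>2"] pos by simp
  qed
  have P0: "P \<ge> 0" unfolding P_def using A1 by (intro prod_nonneg) (meson order_trans zero_le_one)
  have "P * (1 + 2 * s) \<le> 1 / sqrt (1 - s\<^sup>2) * (1 + 2 * s)"
    using prod_coeff_A_le[OF F S] s01 by (intro mult_right_mono) (auto simp: P_def s)
  also have "\<dots> \<le> 1 + 3 * s" by (rule inverse_sqrt_times_le[OF s01])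
  finally have PW: "P * (1 + 2 * s) \<le> 1 + 3 * s" .
  have Cp: "C powr (1 / p) \<le> lp_norm p (\<lambda>n. sqrt (ln (\<bar>coeff_A F n\<bar>\<^sup>2)))"
  proof -
    let ?g = "\<lambda>n. norm (sqrt (ln (\<bar>coeff_A F n\<bar>\<^sup>2))) powr p"
    have "infsum ?g UNIV = infsum ?g S"
      by (rule infsum_cong_neutral) (auto simp: S_def coeff_A_def)
    also have "\<dots> = sum ?g S" using S by simp
    finally have eq: "infsum ?g UNIV = sum ?g S" .
    have "cmod (F n) \<le> norm (sqrt (ln (\<bar>coeff_A F n\<bar>\<^sup>2)))" for n
      using real_le_rsqrt[OF A2[of n]] by simp
    then have "C \<le> sum ?g S"
      unfolding C_def using assms(1) by (intro sum_mono powr_mono2) auto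
    then show ?thesis unfolding lp_norm_def eq using C0 assms(1) by (intro powr_mono2) auto
  qed

  \<comment> \<open>Pointwise bound by truncated linear sums\<close>
  define ns where "ns = sorted_list_of_set S"
  have ns: "set ns = S" "distinct ns" using S by (simp_all add: ns_def)
  define L where "L = length ns"
  define f where "f i t = (\<Sum>n\<in>set (take i ns). F n * cis (2 * pi * of_int n * t))" for i t
  \<comment> \<open>Index \<open>L\<close> carries the full linear sum with weight 1. The smaller
    indices carry the correction terms, the factor 2 being the bound \<open>R\<close> for the
    exponential.\<close>
  define w where "w i = (if i < L then 2 * cmod (F (ns ! i)) else 1)" for i
  have w0: "w i \<ge> 0" for i by (simp add: w_def)
  have sum_nth: "(\<Sum>i<L. cmod (F (ns ! i))) = s"
    using sum_list_distinct_conv_sum_set[OF ns(2), of "\<lambda>n. cmod (F n)"] ns(1)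
    by (simp add: sum_list_sum_nth L_def s atLeast0LessThan)
  have W: "(\<Sum>i<Suc L. w i) = 1 + 2 * s"
    by (simp add: w_def flip: sum_nth sum_distrib_left)
  have pointwise: "norm (sqrt (ln ((cmod (su11_a F t))\<^sup>2))) \<le> P * (\<Sum>i<Suc L. w i * cmod (f i t))" for t
  proof -
    define zs where "zs = map (\<lambda>n. F n * cis (2 * pi * of_int n * t)) ns"
    have b: "su11_b F t = of_real P * reduced_b zs"
      using ordered_matrix_prod_eq_reduced(2)[where F = F and t = t and ns = ns, OF F] prod.distinct_set_conv_list[OF ns(2), of "coeff_A F"] ns(1)
      by (simp add: su11_b_def su11_product_def ns_def S_def zs_def P_def)
    have "map cmod zs = map (\<lambda>n. cmod (F n)) ns" by (simp add: zs_def norm_mult)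
    then have "sum_list (map cmod zs) = s"
      using sum_list_distinct_conv_sum_set[OF ns(2), of "\<lambda>n. cmod (F n)"] ns(1) s by simp
    then have "exp (sum_list (map cmod zs)) \<le> exp (1 / 2)" using s01 by simp
    also have "\<dots> \<le> 2" by (rule exp_half_le2)
    finally have R: "exp (sum_list (map cmod zs)) \<le> 2" .
    have take: "sum_list (take i zs) = f i t" for i
      using sum_list_distinct_conv_sum_set[of "take i ns" "\<lambda>n. F n * cis (2 * pi * of_int n * t)"] ns(2)
      by (simp add: zs_def f_def take_map)
    have len: "length zs = L" by (simp add: zs_def L_def)
    have "cmod (reduced_b zs) \<le> cmod (f L t) + (\<Sum>i<L. 2 * cmod (zs ! i) * cmod (f i t))"
      using norm_reduced_b_le[OF R] take[of L] len by (simp add: take)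
    also have "\<dots> = (\<Sum>i<Suc L. w i * cmod (f i t))"
      by (simp add: w_def zs_def L_def norm_mult)
    finally have "cmod (su11_b F t) \<le> P * (\<Sum>i<Suc L. w i * cmod (f i t))"
      unfolding b using P0 by (simp add: norm_mult mult_left_mono)
    moreover have "(cmod (su11_a F t))\<^sup>2 = 1 + (cmod (su11_b F t))\<^sup>2"
      using su11_product_in_SU11(2)[where F = F and t = t, OF F] by simp
    then have "sqrt (ln ((cmod (su11_a F t))\<^sup>2)) \<le> cmod (su11_b F t)" "ln ((cmod (su11_a F t))\<^sup>2) \<ge> 0"
      by (auto intro!: real_le_lsqrt ln_add_one_self_le_self)
    ultimately show ?thesis by simp
  qed

  \<comment> \<open>Integration and collection of the constants\<close>
  define K where "K = P powr q * (1 + 2 * s) powr (q - 1)"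
  have K0: "K \<ge> 0" by (simp add: K_def)
  have bound: "norm (sqrt (ln ((cmod (su11_a F t))\<^sup>2))) powr q \<le> (\<Sum>i<Suc L. K * w i * cmod (f i t) powr q)" for t
  proof -
    have "norm (sqrt (ln ((cmod (su11_a F t))\<^sup>2))) powr q \<le> (P * (\<Sum>i<Suc L. w i * cmod (f i t))) powr q"
      using pointwise q by (intro powr_mono2) auto
    also have "\<dots> = P powr q * (\<Sum>i<Suc L. w i * cmod (f i t)) powr q"
      by (rule powr_mult)
    also have "\<dots> \<le> P powr q * ((1 + 2 * s) powr (q - 1) * (\<Sum>i<Suc L. w i * cmod (f i t) powr q))"
      using weighted_power_mean[of "{..<Suc L}" w "\<lambda>i. cmod (f i t)" q] w0 q unfolding W
      by (intro mult_left_mono) auto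
    also have "\<dots> = (\<Sum>i<Suc L. K * w i * cmod (f i t) powr q)"
      by (simp only: K_def sum_distrib_left mult.assoc)
    finally show ?thesis .
  qed
  have f_int: "set_integrable lborel {0..<1} (\<lambda>t. cmod (f i t) powr q)" for i
    unfolding f_def using q by (intro set_integrable_trig_poly_powr) simp
  \<comment> \<open>Each truncation is a trigonometric polynomial with part of the coefficients, so
    Hausdorff-Young applies to each one separately and no maximal function enters.\<close>
  have f_le: "(LINT t:{0..<1}|lborel. cmod (f i t) powr q) \<le> C powr (q / p)" for i
  proof -
    have "(LINT t:{0..<1}|lborel. cmod (f i t) powr q) \<le> (\<Sum>n\<in>set (take i ns). cmod (F n) powr p) powr (q / p)"
      unfolding f_def by (intro Hausdorff_Young_trig_poly assms) simp
    also have "\<dots> \<le> C powr (q / p)"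
      unfolding C_def using S set_take_subset[of i ns] ns(1) assms(1) q
      by (intro powr_mono2 sum_mono2 sum_nonneg) auto
    finally show ?thesis .
  qed
  have "(LINT t:{0..<1}|lborel. norm (sqrt (ln ((cmod (su11_a F t))\<^sup>2))) powr q)
      \<le> (LINT t:{0..<1}|lborel. (\<Sum>i<Suc L. K * w i * cmod (f i t) powr q))"
    using q bound by (intro set_integral_mono integrable_su11_a F set_integrable_sum set_integrable_mult_right f_int) auto
  also have "\<dots> = (\<Sum>i<Suc L. K * w i * (LINT t:{0..<1}|lborel. cmod (f i t) powr q))"
    using f_int by (subst set_integral_sum) auto
  also have "\<dots> \<le> (\<Sum>i<Suc L. K * w i * C powr (q / p))"
    using f_le K0 w0 by (intro sum_mono mult_left_mono) auto
  \<comment> \<open>The total weight \<open>1 + 2 * s\<close> joins its power \<open>q - 1\<close>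
    inside \<open>K\<close> to form a full \<open>q\<close>-th power, so that the
    \<open>q\<close>-th root costs exactly \<open>P * (1 + 2 * s)\<close>.\<close>
  also have "\<dots> = K * (1 + 2 * s) * C powr (q / p)"
    by (simp only: W flip: sum_distrib_left sum_distrib_right)
  also have "\<dots> = (P * (1 + 2 * s) * C powr (1 / p)) powr q"
  proof -
    have "(1 + 2 * s) powr (q - 1) * (1 + 2 * s) = (1 + 2 * s) powr q"
      using s01 by (simp add: powr_diff)
    then show ?thesis
      using P0 s01 by (simp add: K_def powr_mult powr_powr mult.assoc)
  qed
  finally have "Lq_norm q (\<lambda>t. sqrt (ln ((cmod (su11_a F t))\<^sup>2)))
      \<le> ((P * (1 + 2 * s) * C powr (1 / p)) powr q) powr (1 / q)"
    unfolding Lq_norm_def using q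
    by (intro powr_mono2) (auto simp: set_lebesgue_integral_def intro!: Bochner_Integration.integral_nonneg)
  also have "\<dots> = P * (1 + 2 * s) * C powr (1 / p)"
    using P0 s01 q by (simp add: powr_powr)
  also have "\<dots> \<le> (1 + 3 * s) * lp_norm p (\<lambda>n. sqrt (ln (\<bar>coeff_A F n\<bar>\<^sup>2)))"
    using PW Cp s01 by (intro mult_mono) auto
  finally show ?thesis by (simp only: s_def)
qed

end
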